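(* Suppose $\kappa$ is a regular cardinal, $A$ is a set of ordinals with $\kappa\le|A|$, and $I\supseteq I_{\kappa,A}$ is an ideal on $P_\kappa A$. Then ${\mathcal R}am_\sqsubset(I)$ is a strongly normal ideal on $P_\kappa A$.
   Context: $P_\kappa A$ is the set of subsets of $A$ of cardinality $<\kappa$. For an ideal $J$ on $P_\kappa A$, $J^+=\{X\subseteq P_\kappa A: X\notin J\}$. A set $S\subseteq P_\kappa A$ is unbounded if for every $x\in P_\kappa A$ there is $y\in S$ with $x\subseteq y$; $I_{\kappa,A}$ is the ideal of subsets of $P_\kappa A$ that are not unbounded. For $x\in P_\kappa A$ let $\kappa_x=|x\cap\kappa|$; $x\sqsubset y$ means $x\subseteq y$ and $|x|<|y\cap\kappa|$. For $S\subseteq P_\kappa A$ and $n\ge1$, $[S]^n_\sqsubset=\{(x_1,\dots,x_n)\in S^n:x_1\sqsubset\cdots\sqsubset x_n\}$, $[S]^{<\omega}_\sqsubset=\bigcup_n[S]^n_\sqsubset$. A function $f:[S]^{<\omega}_\sqsubset\to P_\kappa A$ is $\sqsubset$-regressive if $f(x_1,\dots,x_n)\sqsubset x_1$ always; $H\subseteq S$ is homogeneous for $f$ if $f\upharpoonright[H]^n_\sqsubset$ is constant for each $n$. ${\mathcal R}am_\sqsubset(I)$ is the ideal on $P_\kappa A$ such that $S\in{\mathcal R}am_\sqsubset(I)^+$ iff every $\sqsubset$-regressive $f:[S]^{<\omega}_\sqsubset\to P_\kappa A$ has a homogeneous set $H\subseteq S$ with $H\in I^+$. An ideal $J$ on $P_\kappa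 A$ is strongly normal if for every $S\in J^+$ and every $h:S\to P_\kappa A$ with $h(x)\sqsubset x$ for all $x\in S$, there is $T\subseteq S$ with $T\in J^+$ on which $h$ is constant.
   Formalization: The formal statement additionally assumes that A ∩ κ is infinite (automatic if κ ⊆ A); with only κ ≤ |A| the claim fails, e.g. κ = ω₁, A = {0,1} ∪ [ω₁, ω₂), I = I_{κ,A}. *)

theory Defs
  imports Main
begin

unbundle cardinal_syntax

text \<open>
  Ordinals are the elements of an arbitrary well-ordered type \<open>'a\<close>, and an ordinal \<open>\<kappa>\<close> is identified
  with the set \<open>{..<\<kappa>}\<close> of its predecessors. Thus \<open>x \<inter> \<kappa>\<close> becomes \<open>x \<inter> {..<\<kappa>}\<close>. Cardinalities are
  compared with \<open><o\<close> and \<open>\<le>o\<close>.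
\<close>

definition ordinal_rel :: "'a::wellorder \<Rightarrow> 'a rel" where
  "ordinal_rel \<kappa> = {(\<alpha>, \<beta>). \<alpha> \<le> \<beta> \<and> \<beta> < \<kappa>}"

text \<open>\<open>Card_order\<close> says that \<open>\<kappa>\<close> is an initial ordinal; regular cardinals are infinite.\<close>

definition regular_cardinal :: "'a::wellorder \<Rightarrow> bool" where
  "regular_cardinal \<kappa> \<longleftrightarrow>
     infinite {..<\<kappa>} \<and> Card_order (ordinal_rel \<kappa>) \<and> regularCard (ordinal_rel \<kappa>)"

definition Pk :: "'a::wellorder \<Rightarrow> 'a set \<Rightarrow> 'a set set" where
  "Pk \<kappa> A = {x. x \<subseteq> A \<and> |x| <o |{..<\<kappa>}|}"

text \<open>Ideals are not required to be proper, nor closed under infinite unions.\<close>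

definition ideal_on :: "'b set \<Rightarrow> 'b set set \<Rightarrow> bool" where
  "ideal_on Z J \<longleftrightarrow> J \<subseteq> Pow Z \<and> {} \<in> J \<and>
     (\<forall>X\<in>J. \<forall>Y. Y \<subseteq> X \<longrightarrow> Y \<in> J) \<and> (\<forall>X\<in>J. \<forall>Y\<in>J. X \<union> Y \<in> J)"

definition positive :: "'b set \<Rightarrow> 'b set set \<Rightarrow> 'b set set" where
  "positive Z J = {X. X \<subseteq> Z \<and> X \<notin> J}"

definition unbounded :: "'a::wellorder \<Rightarrow> 'a set \<Rightarrow> 'a set set \<Rightarrow> bool" where
  "unbounded \<kappa> A S \<longleftrightarrow> S \<subseteq> Pk \<kappa> A \<and> (\<forall>x\<in>Pk \<kappa> A. \<exists>y\<in>S. x \<subseteq> y)"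

definition bounded_ideal :: "'a::wellorder \<Rightarrow> 'a set \<Rightarrow> 'a set set set" where
  "bounded_ideal \<kappa> A = {S. S \<subseteq> Pk \<kappa> A \<and> \<not> unbounded \<kappa> A S}"

definition prec :: "'a::wellorder \<Rightarrow> 'a set \<Rightarrow> 'a set \<Rightarrow> bool" where
  "prec \<kappa> x y \<longleftrightarrow> x \<subseteq> y \<and> |x| <o |y \<inter> {..<\<kappa>}|"

text \<open>The tuples \<open>x\<^sub>1 \<sqsubset> \<dots> \<sqsubset> x\<^sub>n\<close> from \<open>S\<close>, as lists of length \<open>n\<close>.\<close>

definition chains :: "'a::wellorder \<Rightarrow> 'a set set \<Rightarrow> nat \<Rightarrow> 'a set list set" where
  "chains \<kappa> S n = {xs. length xs = n \<and> set xs \<subseteq> S \<and> successively (prec \<kappa>) xs}"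

definition finite_chains :: "'a::wellorder \<Rightarrow> 'a set set \<Rightarrow> 'a set list set" where
  "finite_chains \<kappa> S = (\<Union>n\<in>{1..}. chains \<kappa> S n)"

text \<open>Only the values of \<open>f\<close> on \<open>finite_chains \<kappa> S\<close> matter here and below.\<close>

definition regressive :: "'a::wellorder \<Rightarrow> 'a set \<Rightarrow> 'a set set \<Rightarrow> ('a set list \<Rightarrow> 'a set) \<Rightarrow> bool" where
  "regressive \<kappa> A S f \<longleftrightarrow> (\<forall>xs\<in>finite_chains \<kappa> S. f xs \<in> Pk \<kappa> A \<and> prec \<kappa> (f xs) (hd xs))"

definition homogeneous :: "'a::wellorder \<Rightarrow> 'a set set \<Rightarrow> ('a set list \<Rightarrow> 'a set) \<Rightarrow> 'a set set \<Rightarrow> bool" where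
  "homogeneous \<kappa> S f H \<longleftrightarrow> H \<subseteq> S \<and> (\<forall>n\<ge>1. \<exists>c. \<forall>xs\<in>chains \<kappa> H n. f xs = c)"

definition Ram :: "'a::wellorder \<Rightarrow> 'a set \<Rightarrow> 'a set set set \<Rightarrow> 'a set set set" where
  "Ram \<kappa> A I = {S. S \<subseteq> Pk \<kappa> A \<and>
     \<not> (\<forall>f. regressive \<kappa> A S f \<longrightarrow> (\<exists>H\<in>positive (Pk \<kappa> A) I. homogeneous \<kappa> S f H))}"

definition strongly_normal :: "'a::wellorder \<Rightarrow> 'a set \<Rightarrow> 'a set set set \<Rightarrow> bool" where
  "strongly_normal \<kappa> A J \<longleftrightarrow>
     (\<forall>S\<in>positive (Pk \<kappa> A) J. \<forall>h. (\<forall>x\<in>S. h x \<in> Pk \<kappa> A \<and> prec \<kappa> (h x) x) \<longrightarrow>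
        (\<exists>T\<subseteq>S. T \<in> positive (Pk \<kappa> A) J \<and> (\<exists>c. \<forall>x\<in>T. h x = c)))"

text \<open>
  The relation \<open>\<sqsubset>\<close> tacitly presupposes that \<open>A\<close> contains enough ordinals below \<open>\<kappa>\<close>. Usually
  \<open>{..<\<kappa>} \<subseteq> A\<close>; for strong normality of \<open>Ram \<kappa> A I\<close> it is enough that \<open>A \<inter> {..<\<kappa>}\<close> is infinite. The
  bare assumption that \<open>A\<close> has cardinality at least \<open>\<kappa>\<close> does not suffice: if \<open>\<kappa> = \<omega>\<^sub>1\<close>, \<open>|A| = \<omega>\<^sub>2\<close> and
  \<open>A \<inter> \<kappa>\<close> has two elements, then \<open>Ram \<kappa> A (bounded_ideal \<kappa> A)\<close> is not strongly normal. Take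
  an injection \<open>g\<close> from \<open>A \<times> A\<close> to \<open>A\<close> and the set of all \<open>x \<supseteq> A \<inter> \<kappa>\<close> not closed under \<open>g\<close>.
\<close>

end

theory Submission
  imports Defs
begin

text \<open>
  A function without a positive homogeneous set is called bad here. If \<open>f\<close> is bad on \<open>S\<close> and
  \<open>g\<close> is bad on \<open>T - S\<close>, then acting as \<open>f\<close> on chains in \<open>S\<close> and as \<open>g\<close> on chains in \<open>T - S\<close> is bad
  on \<open>S \<union> T\<close>. For strong normality let \<open>h\<close> be regressive on \<open>S\<close> and suppose that every fibre \<open>h = c\<close>
  carries a bad function \<open>f\<^sub>c\<close>. If every \<open>x\<close> has some \<open>y\<close> with \<open>x \<sqsubset> y\<close>, then \<open>(x\<^sub>1) \<mapsto> h x\<^sub>1\<close>,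
  \<open>(x\<^sub>1, \<dots>, x\<^sub>n\<^sub>+\<^sub>1) \<mapsto> f\<^sub>c (x\<^sub>1, \<dots>, x\<^sub>n)\<close> with \<open>c = h x\<^sub>1\<close> is bad on \<open>S\<close>, because every chain in an unbounded
  set extends there. Otherwise (for instance if \<open>\<kappa>\<close> is a successor) there is an infinite \<open>M \<subseteq> A \<inter> \<kappa>\<close>
  in \<open>Pk \<kappa> A\<close> of largest cardinality; the sets containing \<open>M\<close> admit no chains of length two, and
  the pair of \<open>h x\<close> and \<open>f\<^sub>c (x)\<close> can be coded by a single subset of \<open>x\<close> of size less than \<open>|M|\<close>.
\<close>

section \<open>Coding pairs of small sets\<close>

lemma card_of_subset_ordLess: "x \<subseteq> y \<Longrightarrow> |y| <o r \<Longrightarrow> |x| <o r"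
  by (rule ordLeq_ordLess_trans[OF card_of_mono1])

lemma card_of_image_ordLess: "|x| <o r \<Longrightarrow> |f ` x| <o r"
  by (rule ordLeq_ordLess_trans[OF card_of_image])

text \<open>The part \<open>d\<close> of \<open>u \<union> v\<close> outside \<open>M\<close> is
  stored literally. Since \<open>M \<union> d\<close> injects into \<open>M\<close>, copies of
  \<open>u\<close> and \<open>v\<close> can be stored inside \<open>M\<close> as a disjoint sum.
  Decoding works because the injection depends on \<open>d\<close> alone, and \<open>d\<close> can
  be read off the code.\<close>

lemma pair_coding:
  fixes M :: "'a set"
  assumes "infinite M"
  defines "K \<equiv> {u. |u| <o |M|}"
  obtains code :: "'a set \<Rightarrow> 'a set \<Rightarrow> 'a set"
  where "\<And>u v. u \<in> K \<Longrightarrow> v \<in> K \<Longrightarrow> code u v \<in> K"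
    and "\<And>u v. u \<in> K \<Longrightarrow> v \<in> K \<Longrightarrow> code u v \<subseteq> u \<union> v \<union> M"
    and "\<And>u v u' v'. u \<in> K \<Longrightarrow> v \<in> K \<Longrightarrow> u' \<in> K \<Longrightarrow> v' \<in> K \<Longrightarrow>
           code u v = code u' v' \<Longrightarrow> u = u' \<and> v = v'"
proof -
  have "|M <+> M| \<le>o |M|"
    using ordIso_imp_ordLeq[OF card_of_Plus_infinite1[OF assms(1) ordLeq_refl[OF card_of_Card_order]]] .
  then obtain p where p: "inj_on p (M <+> M)" "p ` (M <+> M) \<subseteq> M"
    unfolding card_of_ordLeq[symmetric] by auto
  \<comment> \<open>As \<open>M\<close> is infinite, adding fewer than \<open>|M|\<close> points
    does not enlarge it. One injection is then fixed for each \<open>d\<close>.\<close>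
  have "\<exists>k. inj_on k (M \<union> d) \<and> k ` (M \<union> d) \<subseteq> M" if "d \<in> K" for d
  proof -
    have "|d| \<le>o |M|" using that ordLess_imp_ordLeq unfolding K_def by blast
    then have "|M \<union> d| \<le>o |M|"
      using ordLeq_ordIso_trans[OF card_of_Un_Plus_ordLeq card_of_Plus_infinite1[OF assms(1)]]
      by simp
    then show ?thesis unfolding card_of_ordLeq[symmetric] by auto
  qed
  then obtain k where k: "inj_on (k d) (M \<union> d)" "k d ` (M \<union> d) \<subseteq> M" if "d \<in> K" for d
    by metis
  define D where "D u v = (u \<union> v) - M" for u v :: "'a set"
  define code where "code u v = D u v \<union> p ` (k (D u v) ` u <+> k (D u v) ` v)" for u v
  have D: "D u v \<in> K" if "u \<in> K" "v \<in> K" for u v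
  proof -
    have "|u \<union> v| <o |M|"
      using that assms(1) unfolding K_def by (intro card_of_Un_ordLess_infinite) auto
    then show ?thesis
      unfolding K_def D_def by (auto intro: card_of_subset_ordLess[OF Diff_subset])
  qed
  have sub: "k (D u v) ` u <+> k (D u v) ` v \<subseteq> M <+> M" if "u \<in> K" "v \<in> K" for u v
    using k(2)[OF D[OF that]] unfolding D_def by blast
  have img: "p ` (k (D u v) ` u <+> k (D u v) ` v) \<subseteq> M" if "u \<in> K" "v \<in> K" for u v
    using sub[OF that] p(2) by blast
  show ?thesis
  proof (rule that[of code])
    fix u v assume uv: "u \<in> K" "v \<in> K"
    have "|k (D u v) ` w| <o |M|" if "w \<in> K" for w
      using that unfolding K_def by (simp add: card_of_image_ordLess)
    then have "|k (D u v) ` u <+> k (D u v) ` v| <o |M|"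
      using uv assms(1) by (intro card_of_Plus_ordLess_infinite) auto
    then have "|p ` (k (D u v) ` u <+> k (D u v) ` v)| <o |M|"
      by (rule card_of_image_ordLess)
    then show "code u v \<in> K"
      using D[OF uv] assms(1) unfolding code_def K_def
      by (auto intro!: card_of_Un_ordLess_infinite)
    show "code u v \<subseteq> u \<union> v \<union> M"
      using img[OF uv] unfolding code_def D_def by blast
  next
    fix u v u' v'
    assume K: "u \<in> K" "v \<in> K" "u' \<in> K" "v' \<in> K" and eq: "code u v = code u' v'"
    \<comment> \<open>Decoding: \<open>d\<close> lies off \<open>M\<close> and the packed sum lies
      in \<open>M\<close>, so the two pieces of the code do not mix.\<close>
    have part: "code u v - M = D u v" "code u v \<inter> M = p ` (k (D u v) ` u <+> k (D u v) ` v)"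
      if "u \<in> K" "v \<in> K" for u v
      using img[OF that] unfolding code_def D_def by blast+
    have d: "D u' v' = D u v" using part(1) K eq by metis
    have "p ` (k (D u v) ` u <+> k (D u v) ` v) = p ` (k (D u v) ` u' <+> k (D u v) ` v')"
      using part(2) K eq d by metis
    then have "k (D u v) ` u <+> k (D u v) ` v = k (D u v) ` u' <+> k (D u v) ` v'"
      using inj_on_image_eq_iff[OF p(1)] sub K d by metis
    then have "k (D u v) ` u = k (D u v) ` u'" "k (D u v) ` v = k (D u v) ` v'"
      by blast+
    \<comment> \<open>All four sets lie in the domain on which the common injection
      \<open>k (D u v)\<close> is injective, so equal images come from equal sets.\<close>
    moreover have "u \<subseteq> M \<union> D u v" "v \<subseteq> M \<union> D u v" "u' \<subseteq> M \<union> D u v" "v' \<subseteq> M \<union> D u v"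
      using d unfolding D_def by blast+
    ultimately show "u = u' \<and> v = v'"
      using inj_on_image_eq_iff[OF k(1)[OF D]] K by metis
  qed
qed

section \<open>The Ramsey ideal\<close>

lemma ideal_onD:
  assumes "ideal_on Z J"
  shows "{} \<in> J" "X \<in> J \<Longrightarrow> Y \<subseteq> X \<Longrightarrow> Y \<in> J" "X \<in> J \<Longrightarrow> Y \<in> J \<Longrightarrow> X \<union> Y \<in> J"
  using assms unfolding ideal_on_def by blast+

lemma Ram_iff:
  "S \<in> Ram \<kappa> A I \<longleftrightarrow> S \<subseteq> Pk \<kappa> A \<and>
     (\<exists>f. regressive \<kappa> A S f \<and> (\<forall>H\<in>positive (Pk \<kappa> A) I. \<not> homogeneous \<kappa> S f H))"
  unfolding Ram_def by auto

lemma Ram_family: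
  assumes "\<And>c. X c \<in> Ram \<kappa> A I"
  obtains f where "\<And>c. regressive \<kappa> A (X c) (f c)"
    and "\<And>c H. H \<in> positive (Pk \<kappa> A) I \<Longrightarrow> \<not> homogeneous \<kappa> (X c) (f c) H"
proof -
  have "\<forall>c. \<exists>f. regressive \<kappa> A (X c) f \<and> (\<forall>H\<in>positive (Pk \<kappa> A) I. \<not> homogeneous \<kappa> (X c) f H)"
    using assms unfolding Ram_iff by simp
  from choice[OF this] that show thesis by blast
qed

lemma chains_mono: "S \<subseteq> T \<Longrightarrow> chains \<kappa> S n \<subseteq> chains \<kappa> T n"
  unfolding chains_def by auto

lemma finite_chains_iff:
  "xs \<in> finite_chains \<kappa> S \<longleftrightarrow> xs \<noteq> [] \<and> set xs \<subseteq> S \<and> successively (prec \<kappa>) xs"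
  unfolding finite_chains_def chains_def by (auto simp: Suc_le_eq)

lemma regressiveD:
  assumes "regressive \<kappa> A S f" "xs \<noteq> []" "set xs \<subseteq> S" "successively (prec \<kappa>) xs"
  shows "f xs \<in> Pk \<kappa> A" "prec \<kappa> (f xs) (hd xs)"
proof -
  have "xs \<in> finite_chains \<kappa> S" using assms unfolding finite_chains_iff by blast
  then show "f xs \<in> Pk \<kappa> A" "prec \<kappa> (f xs) (hd xs)"
    using assms(1) unfolding regressive_def by blast+
qed

lemma empty_in_Pk: "x \<in> Pk \<kappa> A \<Longrightarrow> {} \<in> Pk \<kappa> A"
  unfolding Pk_def by (auto intro: card_of_subset_ordLess[of "{}" x])

text \<open>Makes \<open>{}\<close> a safe default value for regressive functions. Some premise is
  needed: \<open>prec \<kappa> {} x\<close> fails if \<open>x\<close> misses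
  \<open>{..<\<kappa>}\<close>.\<close>

lemma prec_empty: "prec \<kappa> u x \<Longrightarrow> prec \<kappa> {} x"
  unfolding prec_def by (auto intro: card_of_subset_ordLess[of "{}" u])

lemma regressive_singleton:
  assumes "regressive \<kappa> A S f" "x \<in> S"
  shows "f [x] \<in> Pk \<kappa> A" "prec \<kappa> (f [x]) x"
  using regressiveD[OF assms(1), of "[x]"] assms(2) by auto

text \<open>Compares a function with one that agrees with it only on the chains of a smaller set, as
  happens when functions are restricted or glued together.\<close>

lemma homogeneous_subset:
  assumes "homogeneous \<kappa> S f H" "H' \<subseteq> H" "H' \<subseteq> S'"
    and "\<And>xs. xs \<in> finite_chains \<kappa> H' \<Longrightarrow> f xs = f' xs"
  shows "homogeneous \<kappa> S' f' H'"
  unfolding homogeneous_def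
proof (intro conjI allI impI)
  fix n :: nat assume n: "n \<ge> 1"
  then obtain c where "\<forall>xs\<in>chains \<kappa> H n. f xs = c"
    using assms(1) unfolding homogeneous_def by blast
  moreover have "xs \<in> finite_chains \<kappa> H'" if "xs \<in> chains \<kappa> H' n" for xs
    using that n unfolding finite_chains_def by auto
  ultimately have "\<forall>xs\<in>chains \<kappa> H' n. f' xs = c"
    using chains_mono[OF assms(2)] assms(4) by (metis subsetD)
  then show "\<exists>c. \<forall>xs\<in>chains \<kappa> H' n. f' xs = c" ..
qed (fact assms(3))

lemma regressive_subset: "regressive \<kappa> A S f \<Longrightarrow> T \<subseteq> S \<Longrightarrow> regressive \<kappa> A T f"
  unfolding regressive_def by (auto simp: finite_chains_iff)

section \<open>Closure of the Ramsey ideal under subsets and finite unions\<close>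

lemma Ram_subset:
  assumes "X \<in> Ram \<kappa> A I" "Y \<subseteq> X"
  shows "Y \<in> Ram \<kappa> A I"
proof -
  obtain f where f: "regressive \<kappa> A X f" "\<forall>H\<in>positive (Pk \<kappa> A) I. \<not> homogeneous \<kappa> X f H"
    using assms(1) unfolding Ram_iff by blast
  have "\<not> homogeneous \<kappa> Y f H" if "H \<in> positive (Pk \<kappa> A) I" for H
    using f(2) that homogeneous_subset[OF _ subset_refl, of \<kappa> Y f H X f] assms(2)
    unfolding homogeneous_def[of _ Y] by blast
  with regressive_subset[OF f(1) assms(2)] assms show ?thesis
    unfolding Ram_iff by blast
qed

lemma Ram_Un_disjoint:
  assumes I: "ideal_on (Pk \<kappa> A) I"
    and "X \<in> Ram \<kappa> A I" "Y \<in> Ram \<kappa> A I" "X \<inter> Y = {}"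
  shows "X \<union> Y \<in> Ram \<kappa> A I"
proof -
  obtain f where f: "regressive \<kappa> A X f" "\<forall>H\<in>positive (Pk \<kappa> A) I. \<not> homogeneous \<kappa> X f H"
    using assms(2) unfolding Ram_iff by blast
  obtain g where g: "regressive \<kappa> A Y g" "\<forall>H\<in>positive (Pk \<kappa> A) I. \<not> homogeneous \<kappa> Y g H"
    using assms(3) unfolding Ram_iff by blast
  \<comment> \<open>Chains meeting both sets receive the default \<open>{}\<close>; nothing is ever
    deduced from their values.\<close>
  define F where "F xs = (if set xs \<subseteq> X then f xs else if set xs \<subseteq> Y then g xs else {})" for xs
  have XY: "X \<subseteq> Pk \<kappa> A" "Y \<subseteq> Pk \<kappa> A" using assms unfolding Ram_iff by auto
  have "regressive \<kappa> A (X \<union> Y) F"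
    unfolding regressive_def
  proof
    fix xs assume xs: "xs \<in> finite_chains \<kappa> (X \<union> Y)"
    then have hd: "hd xs \<in> X \<union> Y" unfolding finite_chains_iff using hd_in_set by blast
    \<comment> \<open>The default is regressive at \<open>hd xs\<close> because \<open>f\<close> or
      \<open>g\<close> already has a regressive value there.\<close>
    then have "{} \<in> Pk \<kappa> A" "prec \<kappa> {} (hd xs)"
      using XY empty_in_Pk regressive_singleton(2)[OF f(1)] regressive_singleton(2)[OF g(1)] prec_empty
      by blast+
    then show "F xs \<in> Pk \<kappa> A \<and> prec \<kappa> (F xs) (hd xs)"
      using xs regressiveD[OF f(1)] regressiveD[OF g(1)] unfolding F_def finite_chains_iff by simp
  qed
  moreover have "\<not> homogeneous \<kappa> (X \<union> Y) F H" if H: "H \<in> positive (Pk \<kappa> A) I" for H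
  proof
    assume hom: "homogeneous \<kappa> (X \<union> Y) F H"
    have "homogeneous \<kappa> X f (H \<inter> X)"
      by (rule homogeneous_subset[OF hom]) (auto simp: finite_chains_iff F_def)
    then have 1: "H \<inter> X \<in> I" using f(2) H unfolding positive_def by blast
    \<comment> \<open>Disjointness ensures that a nonempty chain in \<open>Y\<close> falls through
      the first test of \<open>F\<close> and gets its value from \<open>g\<close>.\<close>
    have disj: "\<not> set xs \<subseteq> X" if "xs \<noteq> []" "set xs \<subseteq> Y" for xs
      using that assms(4) by (cases xs) auto
    have "homogeneous \<kappa> Y g (H \<inter> Y)"
      by (rule homogeneous_subset[OF hom]) (use disj in \<open>auto simp: finite_chains_iff F_def\<close>)
    then have 2: "H \<inter> Y \<in> I" using g(2) H unfolding positive_def by blast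
    have "H = (H \<inter> X) \<union> (H \<inter> Y)" using hom unfolding homogeneous_def by blast
    then show False using ideal_onD(3)[OF I 1 2] H unfolding positive_def by auto
  qed
  ultimately show ?thesis using XY unfolding Ram_iff by blast
qed

lemma ideal_on_Ram:
  assumes I: "ideal_on (Pk \<kappa> A) I"
  shows "ideal_on (Pk \<kappa> A) (Ram \<kappa> A I)"
  unfolding ideal_on_def
proof (intro conjI ballI allI impI)
  show "Ram \<kappa> A I \<subseteq> Pow (Pk \<kappa> A)" unfolding Ram_def by blast
  \<comment> \<open>Over the empty set every function is bad: the only candidate for a homogeneous
    set is \<open>{}\<close>, which lies in \<open>I\<close>.\<close>
  have "regressive \<kappa> A {} f" for f
    unfolding regressive_def by (auto simp: finite_chains_iff)
  then show "{} \<in> Ram \<kappa> A I"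
    using ideal_onD(1)[OF I] unfolding Ram_iff homogeneous_def positive_def by auto
  show "Y \<in> Ram \<kappa> A I" if "X \<in> Ram \<kappa> A I" "Y \<subseteq> X" for X Y
    using Ram_subset[OF that] .
  show "X \<union> Y \<in> Ram \<kappa> A I" if X: "X \<in> Ram \<kappa> A I" and Y: "Y \<in> Ram \<kappa> A I" for X Y
    using Ram_Un_disjoint[OF I X Ram_subset[OF Y, of "Y - X"]] by auto
qed

section \<open>Positive sets and cones\<close>

lemma positive_imp_unbounded:
  assumes "bounded_ideal \<kappa> A \<subseteq> I" "H \<in> positive (Pk \<kappa> A) I"
  shows "unbounded \<kappa> A H"
  using assms unfolding bounded_ideal_def positive_def by blast

text \<open>The discarded members of \<open>H\<close> form a set with no element above
  \<open>M\<close>. It is therefore not unbounded and lies in \<open>I\<close>, so discarding it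
  keeps positivity.\<close>

lemma positive_above:
  assumes "ideal_on (Pk \<kappa> A) I" "bounded_ideal \<kappa> A \<subseteq> I"
    and H: "H \<in> positive (Pk \<kappa> A) I" and M: "M \<in> Pk \<kappa> A"
  shows "{x\<in>H. M \<subseteq> x} \<in> positive (Pk \<kappa> A) I"
proof -
  have "\<not> unbounded \<kappa> A {x\<in>H. \<not> M \<subseteq> x}"
  proof
    assume "unbounded \<kappa> A {x\<in>H. \<not> M \<subseteq> x}"
    then obtain y where "y \<in> {x\<in>H. \<not> M \<subseteq> x}" "M \<subseteq> y"
      using M unfolding unbounded_def by metis
    then show False by simp
  qed
  moreover have "{x\<in>H. \<not> M \<subseteq> x} \<subseteq> Pk \<kappa> A" using H unfolding positive_def by auto
  ultimately have "{x\<in>H. \<not> M \<subseteq> x} \<in> I"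
    using assms(2) unfolding bounded_ideal_def by auto
  moreover have "{x\<in>H. M \<subseteq> x} \<union> {x\<in>H. \<not> M \<subseteq> x} = H" by auto
  ultimately have "{x\<in>H. M \<subseteq> x} \<notin> I"
    using ideal_onD(3)[OF assms(1), of "{x\<in>H. M \<subseteq> x}" "{x\<in>H. \<not> M \<subseteq> x}"] H
    unfolding positive_def by auto
  then show ?thesis using H unfolding positive_def by auto
qed

section \<open>Strong normality\<close>

lemma Ram_fibres_extendible:
  assumes I: "bounded_ideal \<kappa> A \<subseteq> I"
    and inf: "infinite {..<\<kappa>}"
    and ext: "\<And>x. x \<in> Pk \<kappa> A \<Longrightarrow> \<exists>z\<in>Pk \<kappa> A. z \<subseteq> {..<\<kappa>} \<and> |x| <o |z|"
    and S: "S \<subseteq> Pk \<kappa> A"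
    and h: "\<And>x. x \<in> S \<Longrightarrow> h x \<in> Pk \<kappa> A \<and> prec \<kappa> (h x) x"
    and fibres: "\<And>c. {x\<in>S. h x = c} \<in> Ram \<kappa> A I"
  shows "S \<in> Ram \<kappa> A I"
proof -
  obtain f where f: "\<And>c. regressive \<kappa> A {x\<in>S. h x = c} (f c)"
    "\<And>c H. H \<in> positive (Pk \<kappa> A) I \<Longrightarrow> \<not> homogeneous \<kappa> {x\<in>S. h x = c} (f c) H"
    by (rule Ram_family[of "\<lambda>c. {x\<in>S. h x = c}", OF fibres]) (rule that)
  \<comment> \<open>Length one is used up by \<open>h\<close>, so the values of \<open>f\<close> are
    shifted to chains one longer and the last entry is ignored. The image test checks that the
    remaining entries share one fibre, where \<open>f\<close> is regressive.\<close>
  define F where "F xs = (if length xs = 1 then h (hd xs)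
      else if h ` set (butlast xs) = {h (hd xs)} then f (h (hd xs)) (butlast xs) else {})" for xs
  have "regressive \<kappa> A S F"
    unfolding regressive_def
  proof
    fix xs assume "xs \<in> finite_chains \<kappa> S"
    then have xs: "xs \<noteq> []" "set xs \<subseteq> S" "successively (prec \<kappa>) xs"
      unfolding finite_chains_iff by auto
    have hd: "h (hd xs) \<in> Pk \<kappa> A" "prec \<kappa> (h (hd xs)) (hd xs)"
      using h[of "hd xs"] hd_in_set[OF xs(1)] xs(2) by blast+
    show "F xs \<in> Pk \<kappa> A \<and> prec \<kappa> (F xs) (hd xs)"
    proof (cases "length xs \<noteq> 1 \<and> h ` set (butlast xs) = {h (hd xs)}")
      case True
      obtain ys y where xs_eq: "xs = ys @ [y]" using xs(1) by (metis rev_exhaust)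
      then have ys: "ys \<noteq> []" "h ` set ys = {h (hd xs)}" using True by auto
      have sub: "set ys \<subseteq> {x\<in>S. h x = h (hd xs)}"
      proof
        fix x assume x: "x \<in> set ys"
        have "h x = h (hd xs)" using imageI[OF x, of h] unfolding ys(2) by (rule singletonD)
        moreover have "x \<in> S" using x xs(2) xs_eq by auto
        ultimately show "x \<in> {x\<in>S. h x = h (hd xs)}" by (intro CollectI conjI)
      qed
      have "successively (prec \<kappa>) ys"
        using xs(3) xs_eq by (simp add: successively_append_iff)
      note regressiveD[OF f(1) ys(1) sub this]
      moreover have "F xs = f (h (hd xs)) ys" "hd ys = hd xs"
        using True ys(1) xs_eq unfolding F_def by simp_all
      ultimately show ?thesis by simp
    next
      case False
      then show ?thesis
        using hd empty_in_Pk[OF hd(1)] prec_empty[OF hd(2)] unfolding F_def by auto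
    qed
  qed
  moreover have "\<not> homogeneous \<kappa> S F H" if H: "H \<in> positive (Pk \<kappa> A) I" for H
  proof
    assume hom: "homogeneous \<kappa> S F H"
    then obtain c where c: "\<forall>xs\<in>chains \<kappa> H 1. F xs = c"
      unfolding homogeneous_def by blast
    \<comment> \<open>Constancy on one-element chains places \<open>H\<close> inside a single
      fibre.\<close>
    have hc: "h x = c" if "x \<in> H" for x
    proof -
      have "[x] \<in> chains \<kappa> H 1" using that unfolding chains_def by auto
      then show ?thesis using c unfolding F_def by force
    qed
    \<comment> \<open>A member \<open>y\<close> of \<open>H\<close> above
      \<open>x \<union> z\<close> meets \<open>{..<\<kappa>}\<close> in at least \<open>|z|\<close>
      points, which is more than \<open>|x|\<close>.\<close>
    have extend: "\<exists>y\<in>H. prec \<kappa> x y" if x: "x \<in> H" for x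
    proof -
      have xP: "x \<in> Pk \<kappa> A" using x H unfolding positive_def by auto
      then obtain z where z: "z \<in> Pk \<kappa> A" "z \<subseteq> {..<\<kappa>}" "|x| <o |z|" using ext by blast
      have "x \<union> z \<in> Pk \<kappa> A"
        using xP z(1) inf unfolding Pk_def by (auto intro: card_of_Un_ordLess_infinite)
      then obtain y where y: "y \<in> H" "x \<union> z \<subseteq> y"
        using positive_imp_unbounded[OF I H] unfolding unbounded_def by blast
      then have "|z| \<le>o |y \<inter> {..<\<kappa>}|" using z(2) by (intro card_of_mono1) auto
      then show ?thesis
        using y ordLess_ordLeq_trans[OF z(3)] unfolding prec_def by blast
    qed
    have "homogeneous \<kappa> {x\<in>S. h x = c} (f c) H"
      unfolding homogeneous_def
    proof (intro conjI allI impI)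
      show "H \<subseteq> {x\<in>S. h x = c}" using hom hc unfolding homogeneous_def by blast
      fix n :: nat assume n: "n \<ge> 1"
      obtain e where e: "\<forall>xs\<in>chains \<kappa> H (Suc n). F xs = e"
        using hom unfolding homogeneous_def by (metis le_add1 plus_1_eq_Suc)
      \<comment> \<open>Appending any successor \<open>y\<close> of the last entry turns the value
        of \<open>f c\<close> at \<open>xs\<close> into a value of \<open>F\<close> at length
        \<open>Suc n\<close>.\<close>
      have "f c xs = e" if "xs \<in> chains \<kappa> H n" for xs
      proof -
        have xs: "xs \<noteq> []" "set xs \<subseteq> H" "successively (prec \<kappa>) xs" "length xs = n"
          using that n unfolding chains_def by auto
        have "last xs \<in> H" using last_in_set[OF xs(1)] xs(2) by (rule subsetD[rotated])
        then obtain y where y: "y \<in> H" "prec \<kappa> (last xs) y" using extend by metis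
        then have "xs @ [y] \<in> chains \<kappa> H (Suc n)"
          using xs unfolding chains_def by (auto simp: successively_append_iff)
        then have "F (xs @ [y]) = e" using e by blast
        moreover have "h (hd xs) = c" "h ` set xs = {c}" using hc xs hd_in_set[OF xs(1)] by blast+
        ultimately show ?thesis using xs(1) unfolding F_def by simp
      qed
      then show "\<exists>e. \<forall>xs\<in>chains \<kappa> H n. f c xs = e" by blast
    qed
    then show False using f(2)[OF H] by blast
  qed
  ultimately show ?thesis using S unfolding Ram_iff by blast
qed

lemma Ram_fibres_maximal:
  fixes \<kappa> :: "'a::wellorder"
  assumes ideal: "ideal_on (Pk \<kappa> A) I" and I: "bounded_ideal \<kappa> A \<subseteq> I"
    and M: "M \<in> Pk \<kappa> A" "infinite M" "M \<subseteq> {..<\<kappa>}"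
    and max: "\<And>y. y \<in> Pk \<kappa> A \<Longrightarrow> |y \<inter> {..<\<kappa>}| \<le>o |M|"
    and S: "S \<subseteq> Pk \<kappa> A"
    and h: "\<And>x. x \<in> S \<Longrightarrow> h x \<in> Pk \<kappa> A \<and> prec \<kappa> (h x) x"
    and fibres: "\<And>c. {x\<in>S. h x = c} \<in> Ram \<kappa> A I"
  shows "S \<in> Ram \<kappa> A I"
proof -
  obtain f where f: "\<And>c. regressive \<kappa> A {x\<in>S. h x = c} (f c)"
    "\<And>c H. H \<in> positive (Pk \<kappa> A) I \<Longrightarrow> \<not> homogeneous \<kappa> {x\<in>S. h x = c} (f c) H"
    by (rule Ram_family[of "\<lambda>c. {x\<in>S. h x = c}", OF fibres]) (rule that)
  \<comment> \<open>The value at \<open>[x]\<close> of the bad function belonging to the fibre of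
    \<open>x\<close>.\<close>
  define g where "g x = f (h x) [x]" for x
  have g: "prec \<kappa> (g x) x" if "x \<in> S" for x
    using regressive_singleton(2)[OF f(1), of x "h x"] that unfolding g_def by auto
  define K :: "'a set set" where "K = {u. |u| <o |M|}"
  obtain code where code: "\<And>u v. u \<in> K \<Longrightarrow> v \<in> K \<Longrightarrow> code u v \<in> K"
    "\<And>u v. u \<in> K \<Longrightarrow> v \<in> K \<Longrightarrow> code u v \<subseteq> u \<union> v \<union> M"
    "\<And>u v u' v'. u \<in> K \<Longrightarrow> v \<in> K \<Longrightarrow> u' \<in> K \<Longrightarrow> v' \<in> K \<Longrightarrow>
       code u v = code u' v' \<Longrightarrow> u = u' \<and> v = v'"
    using pair_coding[OF M(2)] unfolding K_def by blast
  \<comment> \<open>By maximality of \<open>M\<close>, everything below a member of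
    \<open>Pk \<kappa> A\<close> has fewer than \<open>|M|\<close> elements. This makes
    \<open>h x\<close> and \<open>g x\<close> codable and later rules out longer chains.\<close>
  have small: "u \<in> K" if "prec \<kappa> u x" "x \<in> Pk \<kappa> A" for u x
    using that ordLess_ordLeq_trans[OF _ max] unfolding prec_def K_def by blast
  have hg: "h x \<in> K" "g x \<in> K" if "x \<in> S" for x
    using small h g S that by blast+
  \<comment> \<open>The code may use points of \<open>M\<close>, so it is sure to be a subset of
    \<open>hd xs\<close> only if \<open>M \<subseteq> hd xs\<close>. The default elsewhere is
    harmless, as only one-element chains above \<open>M\<close> are tested.\<close>
  define F where "F xs = (if length xs = 1 \<and> M \<subseteq> hd xs then code (h (hd xs)) (g (hd xs)) else {})"
    for xs
  have "regressive \<kappa> A S F"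
    unfolding regressive_def
  proof
    fix xs assume "xs \<in> finite_chains \<kappa> S"
    then have x: "hd xs \<in> S" unfolding finite_chains_iff using hd_in_set by blast
    show "F xs \<in> Pk \<kappa> A \<and> prec \<kappa> (F xs) (hd xs)"
    proof (cases "length xs = 1 \<and> M \<subseteq> hd xs")
      case True
      let ?w = "code (h (hd xs)) (g (hd xs))"
      have sub: "?w \<subseteq> hd xs"
        using code(2)[OF hg[OF x]] h[OF x] g[OF x] True unfolding prec_def by blast
      then have "?w \<in> Pk \<kappa> A"
        using S x card_of_subset_ordLess[OF sub] unfolding Pk_def by blast
      \<comment> \<open>Here \<open>M \<subseteq> {..<\<kappa>}\<close> matters: a code smaller than
        \<open>M\<close> is smaller than the trace of \<open>hd xs\<close> on
        \<open>{..<\<kappa>}\<close>.\<close>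
      moreover have "|M| \<le>o |hd xs \<inter> {..<\<kappa>}|" using True M(3) by (intro card_of_mono1) auto
      then have "prec \<kappa> ?w (hd xs)"
        using sub code(1)[OF hg[OF x]] ordLess_ordLeq_trans unfolding prec_def K_def by auto
      ultimately show ?thesis using True unfolding F_def by simp
    next
      case False
      then show ?thesis
        using h[OF x] empty_in_Pk prec_empty unfolding F_def by auto
    qed
  qed
  moreover have "\<not> homogeneous \<kappa> S F H" if H: "H \<in> positive (Pk \<kappa> A) I" for H
  proof
    assume hom: "homogeneous \<kappa> S F H"
    let ?H = "{x\<in>H. M \<subseteq> x}"
    have pos: "?H \<in> positive (Pk \<kappa> A) I" using positive_above[OF ideal I H M(1)] .
    then have "?H \<noteq> {}" using ideal_onD(1)[OF ideal] unfolding positive_def by force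
    then obtain x0 where x0: "x0 \<in> ?H" by blast
    obtain e where e: "\<forall>xs\<in>chains \<kappa> H 1. F xs = e"
      using hom unfolding homogeneous_def by blast
    have HS: "H \<subseteq> S" using hom unfolding homogeneous_def by blast
    have val: "code (h x) (g x) = e" if "x \<in> ?H" for x
    proof -
      have "[x] \<in> chains \<kappa> H 1" using that unfolding chains_def by auto
      then show ?thesis using e that unfolding F_def by force
    qed
    have const: "h x = h x0 \<and> g x = g x0" if "x \<in> ?H" for x
    proof -
      have S: "x \<in> S" "x0 \<in> S" using HS that x0 by auto
      show ?thesis by (rule code(3)) (use hg[OF S(1)] hg[OF S(2)] val[OF that] val[OF x0] in auto)
    qed
    have no_prec: "\<not> prec \<kappa> x y" if xy: "x \<in> ?H" "y \<in> ?H" for x y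
    proof
      assume "prec \<kappa> x y"
      moreover have "y \<in> Pk \<kappa> A" using xy H unfolding positive_def by auto
      ultimately have "|x| <o |M|" using small unfolding K_def by blast
      moreover have "|M| \<le>o |x|" using xy by (intro card_of_mono1) auto
      ultimately show False using not_ordLess_ordLeq[of "|x|" "|M|"] by blast
    qed
    have "homogeneous \<kappa> {x\<in>S. h x = h x0} (f (h x0)) ?H"
      unfolding homogeneous_def
    proof (intro conjI allI impI)
      show "?H \<subseteq> {x\<in>S. h x = h x0}" using const HS by blast
      fix n :: nat assume n: "n \<ge> 1"
      \<comment> \<open>Chains in \<open>?H\<close> have length one, so the claim is vacuous for
        larger \<open>n\<close>; for \<open>n = 1\<close> it is the constancy of \<open>h\<close>
        and \<open>g\<close>.\<close>
      have "f (h x0) xs = g x0" if xs: "xs \<in> chains \<kappa> ?H n" for xs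
      proof -
        obtain x ys where ys: "xs = x # ys"
          using xs n unfolding chains_def by (cases xs) auto
        then have "ys = []"
          using xs no_prec unfolding chains_def by (cases ys) auto
        moreover have "x \<in> ?H" using xs ys unfolding chains_def by auto
        ultimately show ?thesis using const[of x] ys unfolding g_def by metis
      qed
      then show "\<exists>c. \<forall>xs\<in>chains \<kappa> ?H n. f (h x0) xs = c" by blast
    qed
    then show False using f(2)[OF pos] by blast
  qed
  ultimately show ?thesis using S unfolding Ram_iff by blast
qed

text \<open>If no larger \<open>z\<close> exists for some \<open>x\<close>, then \<open>|x|\<close>
  bounds the size of every member of \<open>Pk \<kappa> A\<close> inside
  \<open>{..<\<kappa>}\<close>. The set \<open>M\<close> is \<open>A \<inter> {..<\<kappa>}\<close>
  itself if that is no larger than \<open>x\<close>, and otherwise a copy of \<open>x\<close> inside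
  it.\<close>

lemma extendible_or_maximal:
  assumes inf: "infinite {..<\<kappa>}" and A: "infinite (A \<inter> {..<\<kappa>})"
  obtains (extendible) "\<And>x. x \<in> Pk \<kappa> A \<Longrightarrow> \<exists>z\<in>Pk \<kappa> A. z \<subseteq> {..<\<kappa>} \<and> |x| <o |z|"
  | (maximal) M where "M \<in> Pk \<kappa> A" "infinite M" "M \<subseteq> {..<\<kappa>}"
      "\<And>y. y \<in> Pk \<kappa> A \<Longrightarrow> |y \<inter> {..<\<kappa>}| \<le>o |M|"
proof (cases "\<forall>x\<in>Pk \<kappa> A. \<exists>z\<in>Pk \<kappa> A. z \<subseteq> {..<\<kappa>} \<and> |x| <o |z|")
  case True
  then show thesis using extendible by blast
next
  case False
  then obtain x where x: "x \<in> Pk \<kappa> A"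
    and bound: "\<And>z. z \<in> Pk \<kappa> A \<Longrightarrow> z \<subseteq> {..<\<kappa>} \<Longrightarrow> |z| \<le>o |x|"
    using not_ordLess_iff_ordLeq[OF card_of_Well_order card_of_Well_order] by blast
  have Int: "y \<inter> {..<\<kappa>} \<in> Pk \<kappa> A" if "y \<in> Pk \<kappa> A" for y
    using that card_of_subset_ordLess[of "y \<inter> {..<\<kappa>}" y] unfolding Pk_def by auto
  have "\<exists>M. M \<in> Pk \<kappa> A \<and> M \<subseteq> {..<\<kappa>} \<and> (\<forall>y\<in>Pk \<kappa> A. |y \<inter> {..<\<kappa>}| \<le>o |M| )"
  proof (cases "|A \<inter> {..<\<kappa>}| \<le>o |x|")
    case True
    then have "A \<inter> {..<\<kappa>} \<in> Pk \<kappa> A"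
      using x ordLeq_ordLess_trans[OF True] unfolding Pk_def by blast
    moreover have "|y \<inter> {..<\<kappa>}| \<le>o |A \<inter> {..<\<kappa>}|" if "y \<in> Pk \<kappa> A" for y
      using that unfolding Pk_def by (intro card_of_mono1) auto
    ultimately show ?thesis by blast
  next
    case False
    then have "|x| \<le>o |A \<inter> {..<\<kappa>}|"
      using ordLeq_total[OF card_of_Well_order card_of_Well_order] by blast
    then obtain M where M: "M \<subseteq> A \<inter> {..<\<kappa>}" "|x| =o |M|"
      using iffD1[OF internalize_card_of_ordLeq2[of x "A \<inter> {..<\<kappa>}"]] by blast
    then have "M \<in> Pk \<kappa> A"
      using x ordIso_ordLess_trans[OF ordIso_symmetric[OF M(2)]] unfolding Pk_def by blast
    moreover have "|y \<inter> {..<\<kappa>}| \<le>o |M|" if "y \<in> Pk \<kappa> A" for y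
      using ordLeq_ordIso_trans[OF bound[OF Int[OF that]] M(2)] by blast
    ultimately show ?thesis using M(1) by blast
  qed
  then obtain M where M: "M \<in> Pk \<kappa> A" "M \<subseteq> {..<\<kappa>}"
    "\<And>y. y \<in> Pk \<kappa> A \<Longrightarrow> |y \<inter> {..<\<kappa>}| \<le>o |M|"
    by blast
  have "infinite M"
  proof
    assume fin: "finite M"
    \<comment> \<open>A finite \<open>M\<close> would be beaten by a finite subset of the infinite
      set \<open>A \<inter> {..<\<kappa>}\<close> with one more point.\<close>
    obtain z where z: "z \<subseteq> A \<inter> {..<\<kappa>}" "finite z" "card z = Suc (card M)"
      using infinite_arbitrarily_large[OF A] by blast
    have "|z| <o |{..<\<kappa>}|"
      using finite_ordLess_infinite[OF card_of_Well_order card_of_Well_order] z(2) inf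
      by (simp add: Field_card_of)
    then have "z \<in> Pk \<kappa> A" using z(1) unfolding Pk_def by blast
    moreover have "z \<inter> {..<\<kappa>} = z" using z by auto
    ultimately have "|z| \<le>o |M|" using M(3) by metis
    then have "card z \<le> card M"
      using fin card_inj_on_le unfolding card_of_ordLeq[symmetric] by blast
    then show False using z(3) by simp
  qed
  then show thesis using M maximal by blast
qed

lemma strongly_normal_Ram:
  assumes "infinite {..<\<kappa>}" "infinite (A \<inter> {..<\<kappa>})"
    and "ideal_on (Pk \<kappa> A) I" "bounded_ideal \<kappa> A \<subseteq> I"
  shows "strongly_normal \<kappa> A (Ram \<kappa> A I)"
  unfolding strongly_normal_def
proof (intro ballI allI impI)
  fix S h
  assume S: "S \<in> positive (Pk \<kappa> A) (Ram \<kappa> A I)"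
    and h: "\<forall>x\<in>S. h x \<in> Pk \<kappa> A \<and> prec \<kappa> (h x) x"
  have SP: "S \<subseteq> Pk \<kappa> A" using S unfolding positive_def by auto
  have h': "h x \<in> Pk \<kappa> A \<and> prec \<kappa> (h x) x" if "x \<in> S" for x using h that by (rule bspec)
  \<comment> \<open>The set \<open>T\<close> will be a whole fibre of \<open>h\<close>; if all
    fibres were in the ideal, so would be \<open>S\<close>, in either case of the dichotomy.\<close>
  have "\<exists>c. {x\<in>S. h x = c} \<notin> Ram \<kappa> A I"
  proof (rule ccontr)
    assume "\<not> ?thesis"
    then have fibres: "{x\<in>S. h x = c} \<in> Ram \<kappa> A I" for c by simp
    have "S \<in> Ram \<kappa> A I"
      using assms(1,2)
    proof (cases rule: extendible_or_maximal)
      case extendible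
      show ?thesis
        by (rule Ram_fibres_extendible[OF assms(4,1) extendible SP h' fibres])
    next
      case (maximal M)
      show ?thesis
        by (rule Ram_fibres_maximal[OF assms(3,4) maximal SP h' fibres])
    qed
    then show False using S unfolding positive_def by simp
  qed
  then obtain c where "{x\<in>S. h x = c} \<notin> Ram \<kappa> A I" ..
  then have "{x\<in>S. h x = c} \<in> positive (Pk \<kappa> A) (Ram \<kappa> A I)"
    using SP unfolding positive_def by auto
  moreover have "{x\<in>S. h x = c} \<subseteq> S" "\<forall>x\<in>{x\<in>S. h x = c}. h x = c" by simp_all
  ultimately show "\<exists>T\<subseteq>S. T \<in> positive (Pk \<kappa> A) (Ram \<kappa> A I) \<and> (\<exists>c. \<forall>x\<in>T. h x = c)"
    by (intro exI[of _ "{x\<in>S. h x = c}"] conjI exI[of _ c])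
qed

theorem theorem2p5:
  fixes \<kappa> :: "'a::wellorder" and A :: "'a set" and I :: "'a set set set"
  assumes "regular_cardinal \<kappa>"
    and "|{..<\<kappa>}| \<le>o |A|"
    and "infinite (A \<inter> {..<\<kappa>})"
    and "ideal_on (Pk \<kappa> A) I"
    and "bounded_ideal \<kappa> A \<subseteq> I"
  shows "ideal_on (Pk \<kappa> A) (Ram \<kappa> A I) \<and> strongly_normal \<kappa> A (Ram \<kappa> A I)"
proof
  show "ideal_on (Pk \<kappa> A) (Ram \<kappa> A I)" using assms(4) by (rule ideal_on_Ram)
  have "infinite {..<\<kappa>}" using assms(1) unfolding regular_cardinal_def by simp
  then show "strongly_normal \<kappa> A (Ram \<kappa> A I)" using assms(3-5) by (rule strongly_normal_Ram)
qed

end
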